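(* Let $f\in C^2(\mathbb{R})$ satisfy $f(u)>0$, $f'(u)\ge 0$ and $f''(u)>0$ for all $u$, and $\lim_{u\to\infty}f(u)/u=\infty$. Let $\alpha>0$ and $\lambda>0$ be given. Let $L(C)$, $C>0$, be the length function of the Robin problem as defined in the context. Then $L(C)$ is bounded in $\mathbb{R}^+=(0,\infty)$. It satisfies $L(0)=0$ and $L(C)\to 0$ as $C\to\infty$, and it has exactly one critical point in $\mathbb{R}^+$.
   Context: Set $F(u)=\int_0^u f(t)\,dt$, with inverse $F^{-1}:[0,\infty)\to[0,\infty)$, and $\gamma^*=\sqrt{\lambda}/\alpha>0$. For $C>0$ let $v_1=v_1(C)>0$ be the unique positive solution of $F(\gamma^* v_1)+\frac{v_1^2}{2}=C$. Define $$L(C)=2\int_0^{v_1(C)}\frac{dv}{\sqrt{\lambda}\,f\left(F^{-1}\left(C-\frac{v^2}{2}\right)\right)},\qquad L(0)=\lim_{C\to 0^+}L(C).$$ This is the length of the interval on which the solution of $u''+\lambda f(u)=0$, $u'(0)=\alpha u(0)$, $u'(L)=-\alpha u(L)$ with $F(u_{\max})=C$ lives. *)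

theory Defs
  imports "HOL-Analysis.Analysis"
begin

(* Only used for u \<ge> 0: the set integral is unsigned and vanishes for u < 0. *)
definition primitive :: "(real \<Rightarrow> real) \<Rightarrow> real \<Rightarrow> real" where
  "primitive f u = integral {0..u} f"

definition primitive_inv :: "(real \<Rightarrow> real) \<Rightarrow> real \<Rightarrow> real" where
  "primitive_inv f = inv_into {0..} (primitive f)"

definition gamma_star :: "real \<Rightarrow> real \<Rightarrow> real" where
  "gamma_star \<alpha> lam = sqrt lam / \<alpha>"

definition v1 :: "(real \<Rightarrow> real) \<Rightarrow> real \<Rightarrow> real \<Rightarrow> real \<Rightarrow> real" where
  "v1 f \<alpha> lam C = (THE v. v > 0 \<and> primitive f (gamma_star \<alpha> lam * v) + v\<^sup>2 / 2 = C)"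

(* The length of the interval on which the solution of u'' + lam f(u) = 0, u'(0) = \<alpha> u(0),
   u'(L) = - \<alpha> u(L) with primitive f (max u) = C lives.  Meaningful for C > 0 only; the paper's
   L(0) is the limit at 0 from the right. *)
definition robin_length :: "(real \<Rightarrow> real) \<Rightarrow> real \<Rightarrow> real \<Rightarrow> real \<Rightarrow> real" where
  "robin_length f \<alpha> lam C =
     2 * integral {0..v1 f \<alpha> lam C}
           (\<lambda>v. 1 / (sqrt lam * f (primitive_inv f (C - v\<^sup>2 / 2))))"

end

theory Submission
  imports Defs
begin

text \<open>
  Up to the factor \<open>2 / sqrt lam\<close> the length is
  \<open>S(C) = \<integral>\<^sub>0\<^sup>a (F\<^sup>-\<^sup>1)'(C - v\<^sup>2/2) dv\<close> with \<open>a = v\<^sub>1(C)\<close>. It is the time which the orbit of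
  \<open>u' = -v, v' = f(u)\<close> on the level \<open>F(u) + v\<^sup>2/2 = C\<close> needs to go from its highest point
  \<open>v = 0\<close> to the line \<open>u = \<gamma> v\<close> that represents the Robin condition.

  The behaviour at both ends follows from one estimate. Along the orbit \<open>u \<ge> \<gamma> a\<close>, and
  \<open>f\<close> increases, so \<open>0 < S \<le> a / f(\<gamma> a)\<close>. This tends to \<open>0\<close> when \<open>a \<rightarrow> 0\<close> because
  \<open>f \<ge> f(0) > 0\<close> on the positive axis, and when \<open>a \<rightarrow> \<infinity>\<close> because \<open>f\<close> is superlinear.
  A positive function that vanishes at both ends attains its maximum (\<open>interior_maximum_critical\<close>),
  which gives boundedness and one critical point.

  There is no other critical point because \<open>S'' < 0\<close> at every critical point
  (\<open>half_length''_negative\<close>), so that \<open>S'\<close> crosses zero only downwards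
  (\<open>unique_zero_of_downcrossings\<close>). The sign of \<open>S''\<close> comes from the equation
  linearized at the orbit. Let \<open>w\<close> and \<open>z\<close> be the first and second derivative of \<open>u\<close> with
  respect to \<open>C\<close> at fixed time. They satisfy \<open>w'' + f'(u) w = 0\<close> and
  \<open>z'' + f'(u) z = - f''(u) w\<^sup>2\<close>, hence the Wronskian \<open>D = z' w - z w'\<close> has derivative
  \<open>- f''(u) w\<^sup>3\<close> and starts from \<open>0\<close>. The function \<open>w\<close> decreases along the orbit, and at a critical
  \<open>C\<close> its value at the endpoint is \<open>\<gamma> / (\<gamma> f(\<gamma> a) + a) > 0\<close>. So \<open>w > 0\<close>, and convexity of \<open>f\<close>
  makes \<open>D\<close> negative at the endpoint, where it coincides with \<open>S''\<close>.

  All this is carried out with \<open>v\<close> as the independent variable (time is then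
  \<open>\<integral> dv / f(u)\<close>) in terms of the integrals \<open>i\<close> and \<open>j\<close>
  from \<open>0\<close> to \<open>v\<close> of the second and the third derivative of \<open>F\<^sup>-\<^sup>1\<close> at \<open>C - y\<^sup>2/2\<close>,
  so no differential equation has to be solved: \<open>w = 1 / f(u) + v i\<close>, and \<open>D\<close> is the expression in
  \<open>wronskian_deriv\<close>.
\<close>

section \<open>Inverses of increasing functions on the half-line\<close>

text \<open>
  Both inverses that enter the length are of this kind: that of \<open>F\<close>, and that of
  \<open>v \<mapsto> F(\<gamma> v) + v\<^sup>2/2\<close>, whose value at \<open>C\<close> is the upper limit of integration. The derivative
  is required only away from \<open>0\<close> because \<open>primitive\<close> is constant on the negative axis.
\<close>

locale increasing_profile =
  fixes G g :: "real \<Rightarrow> real"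
  assumes at_zero: "G 0 = 0"
    and cont: "\<And>b. continuous_on {0..b} G"
    and deriv: "\<And>x. x > 0 \<Longrightarrow> (G has_real_derivative g x) (at x)"
    and slope_pos: "\<And>x. x > 0 \<Longrightarrow> g x > 0"
    and unbounded: "filterlim G at_top at_top"
begin

abbreviation inverse_profile :: "real \<Rightarrow> real" where
  "inverse_profile \<equiv> inv_into {0..} G"

lemma strictly_increasing: "G x < G y" if "0 \<le> x" "x < y"
proof (rule DERIV_pos_imp_increasing_open[OF that(2)])
  show "\<exists>d. (G has_real_derivative d) (at z) \<and> 0 < d" if "x < z" "z < y" for z
    using deriv[of z] slope_pos[of z] that \<open>0 \<le> x\<close> by auto
  show "continuous_on {x..y} G"
    using cont by (rule continuous_on_subset) (use \<open>0 \<le> x\<close> in auto)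
qed

lemma inj_on_nonneg: "inj_on G {0..}"
  by (rule linorder_inj_onI) (auto dest: strictly_increasing)

lemma attained: "y \<in> G ` {0..}" if "0 \<le> y"
proof -
  from unbounded have "\<forall>\<^sub>F x in at_top. y \<le> G x"
    by (simp add: filterlim_at_top)
  with eventually_ge_at_top[of 0] have "\<forall>\<^sub>F x in at_top. 0 \<le> x \<and> y \<le> G x"
    by eventually_elim simp
  then obtain b where "0 \<le> b" "y \<le> G b"
    using eventually_happens'[OF trivial_limit_at_top_linorder] by blast
  then obtain x where "0 \<le> x" "G x = y"
    using IVT'[of G 0 y b] at_zero \<open>0 \<le> y\<close> cont[of b] by auto
  then show ?thesis by auto
qed

lemma profile_inverse: "G (inverse_profile y) = y" if "0 \<le> y"
  using attained[OF that] by (rule f_inv_into_f)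

lemma inverse_nonneg: "inverse_profile y \<ge> 0" if "0 \<le> y"
  using inv_into_into[OF attained[OF that]] by simp

lemma inverse_of_profile: "inverse_profile (G x) = x" if "0 \<le> x"
  using inv_into_f_f[OF inj_on_nonneg] that by simp

lemma inverse_pos: "inverse_profile y > 0" if "0 < y"
  using inverse_nonneg[of y] profile_inverse[of y] at_zero that
  by (metis less_eq_real_def less_irrefl)

lemma inverse_ge_iff: "x \<le> inverse_profile y \<longleftrightarrow> G x \<le> y" if "0 \<le> x" "0 \<le> y"
  using strictly_increasing[of x "inverse_profile y"] strictly_increasing[of "inverse_profile y" x]
    profile_inverse[of y] inverse_nonneg[of y] that
  by (metis less_eq_real_def linorder_not_less)

lemma inverse_deriv:
  "(inverse_profile has_real_derivative 1 / g (inverse_profile y)) (at y)" if "0 < y"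
proof -
  let ?x = "inverse_profile y"
  have x: "?x > 0" using that by (rule inverse_pos)
  have "(inverse_profile has_derivative (*) (1 / g ?x)) (at y)"
  proof (rule has_derivative_inverse_strong_x)
    show "open {0::real<..}" "?x \<in> {0<..}"
      using x by auto
    show "continuous_on {0<..} G"
      by (rule DERIV_continuous_on[OF has_field_derivative_at_within[OF deriv]]) simp
    show "inverse_profile (G x) = x" if "x \<in> {0<..}" for x
      using that by (intro inverse_of_profile) simp
    show "(G has_derivative (*) (g ?x)) (at ?x)"
      using deriv[OF x] by (simp add: has_field_derivative_def)
    show "(*) (g ?x) \<circ> (*) (1 / g ?x) = id"
      using slope_pos[OF x] by auto
    show "G ?x = y"
      using that by (intro profile_inverse) simp
  qed
  then show ?thesis by (simp add: has_field_derivative_def)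
qed

lemma inverse_tendsto_0: "(inverse_profile \<longlongrightarrow> 0) (at_right 0)"
proof (rule order_tendstoI)
  show "\<forall>\<^sub>F y in at_right 0. e < inverse_profile y" if "e < 0" for e
    using eventually_at_right_less by eventually_elim (use that inverse_pos less_trans in blast)
  show "\<forall>\<^sub>F y in at_right 0. inverse_profile y < e" if e: "0 < e" for e
  proof -
    have "0 < G e" using strictly_increasing[of 0 e] at_zero e by simp
    then have "\<forall>\<^sub>F y in at_right 0. y \<in> {0<..<G e}"
      by (rule eventually_at_right_real)
    then show ?thesis
      by eventually_elim (use inverse_ge_iff[of e] e in \<open>simp add: not_le[symmetric]\<close>)
  qed
qed

lemma inverse_at_top: "filterlim inverse_profile at_top at_top"
  unfolding filterlim_at_top
proof
  fix Z
  have "\<forall>\<^sub>F y in at_top. 0 \<le> y \<and> G (max 0 Z) \<le> y"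
    using eventually_ge_at_top[of 0] eventually_ge_at_top[of "G (max 0 Z)"]
    by eventually_elim simp
  then show "\<forall>\<^sub>F y in at_top. Z \<le> inverse_profile y"
    by eventually_elim (use inverse_ge_iff[of "max 0 Z"] in force)
qed

end

section \<open>Integrals with a moving endpoint\<close>

text \<open>
  The function \<open>k\<close> is controlled only for positive arguments, so the parameter and the endpoint must
  stay in a region where \<open>x - v\<^sup>2/2 > 0\<close>. On such a rectangle the integral is a function of
  two independent variables with continuous partial derivatives, and the claim is the chain rule.
\<close>

lemma moving_endpoint_deriv:
  fixes k k' a :: "real \<Rightarrow> real"
  assumes k: "\<And>x. x > 0 \<Longrightarrow> (k has_real_derivative k' x) (at x)"
    and cont: "continuous_on {0<..} k'"
    and a: "(a has_real_derivative a') (at C)"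
    and a_pos: "0 < a C" and admissible: "(a C)\<^sup>2 / 2 < C"
  shows "((\<lambda>C. integral {0..a C} (\<lambda>v. k (C - v\<^sup>2 / 2))) has_real_derivative
    k (C - (a C)\<^sup>2 / 2) * a' + integral {0..a C} (\<lambda>v. k' (C - v\<^sup>2 / 2))) (at C)"
proof -
  \<comment> \<open>The rectangle: \<open>b\<close> leaves room to the right of \<open>a C\<close> and still satisfies \<open>b\<^sup>2/2 < C\<close>.\<close>
  define b where "b = (a C + sqrt (2 * C)) / 2"
  have "a C < sqrt (2 * C)"
    using admissible by (intro real_less_rsqrt) simp
  then have b: "a C < b" "b < sqrt (2 * C)" "0 < b"
    using a_pos by (auto simp: b_def)
  have bC: "b\<^sup>2 / 2 < C"
  proof -
    have "b\<^sup>2 < (sqrt (2 * C))\<^sup>2"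
      using b by (intro power_strict_mono) auto
    moreover have "0 < C"
      using zero_le_power2[of "a C"] admissible by linarith
    ultimately show ?thesis by simp
  qed
  define X where "X = {b\<^sup>2 / 2<..}"
  define Y where "Y = {0..b}"
  have dom: "0 < x - v\<^sup>2 / 2" if "x \<in> X" "v \<in> Y" for x v
  proof -
    have "v\<^sup>2 \<le> b\<^sup>2" using that b by (intro power_mono) (auto simp: Y_def)
    then show ?thesis using that by (simp add: X_def)
  qed
  have kc: "continuous_on {0<..} k"
    by (rule DERIV_continuous_on[OF has_field_derivative_at_within[OF k]]) simp
  have cont_k: "continuous_on (X \<times> Y) (\<lambda>(x, v). k (x - v\<^sup>2 / 2))"
    unfolding split_beta
    by (intro continuous_on_compose2[OF kc] continuous_intros) (auto dest: dom)
  have cont_k': "continuous_on (X \<times> Y) (\<lambda>(x, v). k' (x - v\<^sup>2 / 2))"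
    unfolding split_beta
    by (intro continuous_on_compose2[OF cont] continuous_intros) (auto dest: dom)
  have slice: "continuous_on Y (\<lambda>v. k (x - v\<^sup>2 / 2))" if "x \<in> X" for x
    by (intro continuous_on_compose2[OF kc] continuous_intros) (use that in \<open>auto dest: dom\<close>)
  define N where "N = (\<lambda>x y. integral {0..y} (\<lambda>v. k (x - v\<^sup>2 / 2)))"
  have CX: "C \<in> X" and aY: "a C \<in> Y"
    using bC b a_pos by (auto simp: X_def Y_def)
  have sub: "cbox 0 (a C) \<subseteq> Y"
    using b by (auto simp: Y_def)
  have dx: "((\<lambda>x. N x (a C)) has_real_derivative integral {0..a C} (\<lambda>v. k' (C - v\<^sup>2 / 2)))
      (at C within X)"
    unfolding N_def cbox_interval[symmetric]
  proof (rule leibniz_rule_field_derivative[of X 0 "a C"])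
    show "((\<lambda>x. k (x - v\<^sup>2 / 2)) has_real_derivative k' (x - v\<^sup>2 / 2)) (at x within X)"
      if "x \<in> X" "v \<in> cbox 0 (a C)" for x v
    proof -
      have E: "0 < x - v\<^sup>2 / 2" using that sub by (intro dom) auto
      have "((\<lambda>x. x - v\<^sup>2 / 2) has_real_derivative 1) (at x within X)"
        by (auto intro!: derivative_eq_intros)
      from DERIV_chain2[OF k[OF E] this] show ?thesis by simp
    qed
    show "(\<lambda>v. k (x - v\<^sup>2 / 2)) integrable_on cbox 0 (a C)" if "x \<in> X" for x
      by (rule integrable_continuous[OF continuous_on_subset[OF slice[OF that] sub]])
    show "continuous_on (X \<times> cbox 0 (a C)) (\<lambda>(x, v). k' (x - v\<^sup>2 / 2))"
      by (rule continuous_on_subset[OF cont_k']) (use sub in auto)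
  qed (use CX in \<open>auto simp: X_def\<close>)
  have "((\<lambda>(x, y). N x y) has_derivative
      (\<lambda>(s, t). integral {0..a C} (\<lambda>v. k' (C - v\<^sup>2 / 2)) * s
         + blinfun_mult_right (k (C - (a C)\<^sup>2 / 2)) t)) (at (C, a C) within X \<times> Y)"
  proof (rule has_derivative_partialsI[where fy = "\<lambda>x y. blinfun_mult_right (k (x - y\<^sup>2 / 2))"])
    show "((\<lambda>x. N x (a C)) has_derivative (*) (integral {0..a C} (\<lambda>v. k' (C - v\<^sup>2 / 2))))
        (at C within X)"
      using dx by (simp add: has_field_derivative_def)
    show "(N x has_derivative blinfun_apply (blinfun_mult_right (k (x - y\<^sup>2 / 2)))) (at y within Y)"
      if "x \<in> X" "y \<in> Y" for x y
      using integral_has_real_derivative[OF slice[OF that(1), unfolded Y_def], of y] that(2)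
      by (simp add: N_def Y_def has_field_derivative_def)
    show "continuous (at (C, a C) within X \<times> Y) (\<lambda>(x, y). blinfun_mult_right (k (x - y\<^sup>2 / 2)))"
    proof -
      have "continuous_on (X \<times> Y) (\<lambda>(x, y). blinfun_mult_right (k (x - y\<^sup>2 / 2)))"
        using bounded_linear.continuous_on[OF bounded_linear_blinfun_mult_right cont_k]
        by (simp add: split_beta)
      then show ?thesis
        unfolding continuous_on_eq_continuous_within by (rule bspec) (simp add: CX aY)
    qed
  qed (use aY in \<open>auto simp: Y_def\<close>)
  moreover have "at (C, a C) within X \<times> Y = at (C, a C)"
    using CX a_pos b by (intro at_within_interior) (auto simp: interior_Times interior_open X_def Y_def)
  ultimately have dN: "((\<lambda>(x, y). N x y) has_derivative
      (\<lambda>(s, t). integral {0..a C} (\<lambda>v. k' (C - v\<^sup>2 / 2)) * s + k (C - (a C)\<^sup>2 / 2) * t))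
      (at (C, a C))"
    by simp
  have "((\<lambda>x. (x, a x)) has_derivative (\<lambda>s. (s, a' * s))) (at C)"
    using a by (auto simp: has_field_derivative_def intro!: derivative_eq_intros)
  from has_derivative_compose[OF this dN] have "((\<lambda>x. N x (a x)) has_derivative
      (\<lambda>s. integral {0..a C} (\<lambda>v. k' (C - v\<^sup>2 / 2)) * s + k (C - (a C)\<^sup>2 / 2) * (a' * s))) (at C)"
    by simp
  then show ?thesis
    unfolding N_def has_field_derivative_def
    by (rule has_derivative_eq_rhs) (auto simp: algebra_simps)
qed

section \<open>Counting critical points\<close>

text \<open>
  To the right of a zero \<open>P\<close> is negative; at the next zero it would have to arrive from below,
  which contradicts the negative derivative there.
\<close>

lemma unique_zero_of_downcrossings:
  fixes P P' :: "real \<Rightarrow> real"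
  assumes P: "\<And>x. x > 0 \<Longrightarrow> (P has_real_derivative P' x) (at x)"
    and down: "\<And>x. x > 0 \<Longrightarrow> P x = 0 \<Longrightarrow> P' x < 0"
    and zeros: "x > 0" "P x = 0" "y > 0" "P y = 0"
  shows "x = y"
proof -
  have False if xy: "0 < x" "x < y" "P x = 0" "P y = 0" for x y
  proof -
    obtain d where d: "d > 0" "\<And>h. 0 < h \<Longrightarrow> h < d \<Longrightarrow> P (x + h) < 0"
      using DERIV_neg_dec_right[OF P[of x] down[of x]] xy by auto
    define h where "h = min (d / 2) ((y - x) / 2)"
    define x' where "x' = x + h"
    have "0 < h" "h < d" "h < y - x"
      using d(1) xy(2) by (auto simp: h_def min_def)
    then have x': "x < x'" "x' < y" "P x' < 0"
      using d(2)[of h] by (auto simp: x'_def)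
    have cont: "continuous_on {x'..t} P" for t
      by (rule DERIV_continuous_on[OF has_field_derivative_at_within[OF P]]) (use x' xy in auto)
    \<comment> \<open>The first zero \<open>z\<close> after \<open>x'\<close>; there is one because \<open>y\<close> is a zero.\<close>
    let ?Z = "{x'..y} \<inter> P -` {0}"
    have "closed ?Z"
      using cont by (rule continuous_closed_preimage) auto
    then have "compact ?Z"
      by (simp add: compact_eq_bounded_closed bounded_Int)
    moreover have "y \<in> ?Z" using x' xy by auto
    ultimately obtain z where z: "z \<in> ?Z" "\<And>t. t \<in> ?Z \<Longrightarrow> z \<le> t"
      using compact_attains_inf[of ?Z] by blast
    have z': "x' < z" "P z = 0" using z x' by (auto simp: less_le)
    obtain d where d: "d > 0" "\<And>h. 0 < h \<Longrightarrow> h < d \<Longrightarrow> P (z - h) > 0"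
      using DERIV_neg_dec_left[OF P[of z] down[of z]] z' x' xy by auto
    define h where "h = min (d / 2) ((z - x') / 2)"
    have "0 < h" "h < d" "h < z - x'"
      using d(1) z'(1) by (auto simp: h_def min_def)
    then have h: "x' < z - h" "z - h < z" "P (z - h) > 0"
      using d(2)[of h] by auto
    then obtain t where "x' \<le> t" "t \<le> z - h" "P t = 0"
      using IVT'[of P x' 0 "z - h"] x' cont[of "z - h"] by auto
    with z(2)[of t] z(1) h show False by auto
  qed
  then show ?thesis using zeros by (metis linorder_less_linear)
qed

text \<open>
  Outside a compact interval \<open>{s..t}\<close> around \<open>1\<close> the function lies below \<open>L 1\<close>, so its
  maximum over that interval is global.
\<close>

lemma interior_maximum_critical:
  fixes L L' :: "real \<Rightarrow> real"
  assumes L: "\<And>x. x > 0 \<Longrightarrow> (L has_real_derivative L' x) (at x)"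
    and pos: "\<And>x. x > 0 \<Longrightarrow> L x > 0"
    and left: "(L \<longlongrightarrow> 0) (at_right 0)" and right: "(L \<longlongrightarrow> 0) at_top"
  obtains x where "x > 0" "L' x = 0" "\<And>y. y > 0 \<Longrightarrow> L y \<le> L x"
proof -
  have L1: "L 1 > 0" by (simp add: pos)
  obtain l where l: "l > 0" "\<And>y. 0 < y \<Longrightarrow> y < l \<Longrightarrow> L y < L 1"
    using order_tendstoD(2)[OF left L1] unfolding eventually_at_right_field by blast
  obtain r where r: "\<And>y. r \<le> y \<Longrightarrow> L y < L 1"
    using order_tendstoD(2)[OF right L1] unfolding eventually_at_top_linorder by blast
  define s where "s = min 1 (l / 2)"
  define t where "t = max 1 r"
  have "continuous_on {s..t} L"
    by (rule DERIV_continuous_on[OF has_field_derivative_at_within[OF L]]) (use l(1) in \<open>auto simp: s_def\<close>)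
  moreover have one: "1 \<in> {s..t}" by (simp add: s_def t_def)
  ultimately obtain x where x: "x \<in> {s..t}" "\<And>y. y \<in> {s..t} \<Longrightarrow> L y \<le> L x"
    using continuous_attains_sup[of "{s..t}" L] by auto
  have x0: "x > 0" using x(1) l(1) by (auto simp: s_def)
  have max: "L y \<le> L x" if "y > 0" for y
  proof (cases "y \<in> {s..t}")
    case False
    then have "y < s \<or> t < y" by auto
    then have "y < l \<or> r \<le> y" using l(1) by (auto simp: s_def t_def)
    then have "L y < L 1" using l(2) r that by blast
    also have "\<dots> \<le> L x" by (rule x(2)[OF one])
    finally show ?thesis by simp
  qed (rule x(2))
  have "L' x = 0"
    by (rule DERIV_local_max[OF L[OF x0] x0]) (auto intro!: max)
  then show ?thesis using that x0 max by blast
qed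


section \<open>The differential identities\<close>

text \<open>
  The case of interest is \<open>p = f \<circ> F\<^sup>-\<^sup>1\<close> and \<open>r = f' \<circ> F\<^sup>-\<^sup>1\<close>: since \<open>(F\<^sup>-\<^sup>1)' = 1 / p\<close>, the
  formulas compute the second and third derivative of \<open>F\<^sup>-\<^sup>1\<close>.
\<close>

lemma reciprocal_powers_deriv:
  fixes p r :: "real \<Rightarrow> real"
  assumes p: "(p has_real_derivative r x / p x) (at x)"
    and r: "(r has_real_derivative r' / p x) (at x)" and nz: "p x \<noteq> 0"
  shows "((\<lambda>x. 1 / p x) has_real_derivative - r x / p x ^ 3) (at x)"
    and "((\<lambda>x. - r x / p x ^ 3) has_real_derivative 3 * (r x)\<^sup>2 / p x ^ 5 - r' / p x ^ 4) (at x)"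
proof -
  show "((\<lambda>x. 1 / p x) has_real_derivative - r x / p x ^ 3) (at x)"
    by (rule DERIV_cong[OF DERIV_divide[OF DERIV_const p nz]])
      (use nz in \<open>simp add: field_simps eval_nat_numeral\<close>)
  show "((\<lambda>x. - r x / p x ^ 3) has_real_derivative 3 * (r x)\<^sup>2 / p x ^ 5 - r' / p x ^ 4) (at x)"
    by (rule DERIV_cong, (rule derivative_eq_intros p r refl | simp add: nz)+)
      (use nz in \<open>simp add: field_simps eval_nat_numeral\<close>)
qed

text \<open>
  Here \<open>p\<close>, \<open>r\<close>, \<open>r'\<close> stand for \<open>f(u)\<close>, \<open>f'(u)\<close>, \<open>f''(u)\<close> along the orbit, where
  \<open>du/dv = - v / f(u)\<close>. With \<open>w = 1/p + v i\<close> for the first variation of \<open>u\<close> at fixed time and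
  \<open>z = - r / p\<^sup>3 + v j - p i\<^sup>2\<close> for the second, the function in the second claim
  is the Wronskian \<open>p (z\<^sub>v w - z w\<^sub>v)\<close>. All terms without \<open>r'\<close> cancel in its derivative, as
  they must since \<open>w\<close> and \<open>z\<close> satisfy equations with the same linear part.
\<close>

lemma wronskian_deriv:
  fixes p r i j :: "real \<Rightarrow> real"
  assumes p: "(p has_real_derivative - v * r v / p v) (at v within S)"
    and r: "(r has_real_derivative - v * r' / p v) (at v within S)"
    and i: "(i has_real_derivative - r v / p v ^ 3) (at v within S)"
    and j: "(j has_real_derivative 3 * (r v)\<^sup>2 / p v ^ 5 - r' / p v ^ 4) (at v within S)"
    and nz: "p v \<noteq> 0"
  shows "((\<lambda>v. 1 / p v + v * i v) has_real_derivative i v) (at v within S)"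
    and "((\<lambda>v. j v + 3 * i v * r v / (p v)\<^sup>2 + 3 * v * (i v)\<^sup>2 * r v / p v
        + v\<^sup>2 * i v ^ 3 * r v + (p v)\<^sup>2 * i v ^ 3)
      has_real_derivative - r' * (1 / p v + v * i v) ^ 3 / p v) (at v within S)"
proof -
  show "((\<lambda>v. 1 / p v + v * i v) has_real_derivative i v) (at v within S)"
    by (rule DERIV_cong, (rule derivative_eq_intros p i refl | simp add: nz)+)
      (use nz in \<open>simp add: field_simps eval_nat_numeral\<close>)
  show "((\<lambda>v. j v + 3 * i v * r v / (p v)\<^sup>2 + 3 * v * (i v)\<^sup>2 * r v / p v
        + v\<^sup>2 * i v ^ 3 * r v + (p v)\<^sup>2 * i v ^ 3)
      has_real_derivative - r' * (1 / p v + v * i v) ^ 3 / p v) (at v within S)"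
    by (rule DERIV_cong, (rule derivative_eq_intros p r i j refl | simp add: nz)+)
      (use nz in \<open>simp add: divide_simps eval_nat_numeral, algebra\<close>)
qed

text \<open>
  The left-hand side is the Wronskian at the endpoint, after the critical point equation has
  determined \<open>I\<close>; the right-hand side is the second derivative of the length. They agree because
  \<open>w\<close> then satisfies the linearized boundary condition, so that \<open>z' w - z w'\<close> is a multiple of
  the boundary expression of \<open>z\<close>, which governs how the length changes to second order.
\<close>

lemma boundary_terms_cancel:
  fixes p q r \<gamma> a I J :: real
  assumes "p > 0" "q > 0" and a: "a = q - \<gamma> * p" and I: "I = - 1 / (p * q)"
  shows "J + 3 * I * r / p\<^sup>2 + 3 * a * I\<^sup>2 * r / p + a\<^sup>2 * I ^ 3 * r + p\<^sup>2 * I ^ 3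
      = - (\<gamma> * r + p * (\<gamma>\<^sup>2 * r + 1) / q) / (p\<^sup>2 * q\<^sup>2) - r / (p ^ 3 * q) + J"
  using assms(1,2) unfolding a I
  by (simp add: divide_simps eval_nat_numeral) algebra


section \<open>The half-length and its derivatives\<close>

locale robin_problem =
  fixes f f' f'' :: "real \<Rightarrow> real" and \<gamma> :: real
  assumes f_deriv: "\<And>u. (f has_real_derivative f' u) (at u)"
    and f'_deriv: "\<And>u. (f' has_real_derivative f'' u) (at u)"
    and f''_cont: "continuous_on UNIV f''"
    and f_pos: "\<And>u. f u > 0"
    and f'_nonneg: "\<And>u. f' u \<ge> 0"
    and f''_pos: "\<And>u. f'' u > 0"
    and superlinear: "filterlim (\<lambda>u. f u / u) at_top at_top"
    and \<gamma>_pos: "\<gamma> > 0"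
begin

lemma f_nonzero [simp]: "f u \<noteq> 0"
  using f_pos[of u] by simp

lemma f_mono: "f x \<le> f y" if "x \<le> y"
  using DERIV_nonneg_imp_nondecreasing[OF that] f_deriv f'_nonneg by blast

lemma f_cont: "continuous_on S f"
  by (rule DERIV_continuous_on[OF has_field_derivative_at_within[OF f_deriv]])

lemma f'_cont: "continuous_on S f'"
  by (rule DERIV_continuous_on[OF has_field_derivative_at_within[OF f'_deriv]])

lemma primitive_deriv_within:
  "(primitive f has_real_derivative f x) (at x within {0..b})" if "x \<in> {0..b}"
  using integral_has_real_derivative[OF f_cont that]
  by (simp add: primitive_def[abs_def])

lemma primitive_deriv: "(primitive f has_real_derivative f x) (at x)" if "x > 0"
  using primitive_deriv_within[of x "x + 1"] that by (simp add: at_within_Icc_at)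

lemma primitive_ge: "f 0 * u \<le> primitive f u" if "0 \<le> u"
proof -
  have "integral {0..u} (\<lambda>_. f 0) \<le> integral {0..u} f"
    by (intro integral_le integrable_continuous_real f_cont continuous_intros) (simp add: f_mono)
  then show ?thesis using that by (simp add: primitive_def mult.commute)
qed

lemma primitive_at_top: "filterlim (primitive f) at_top at_top"
proof (rule filterlim_at_top_mono)
  show "filterlim (\<lambda>u. f 0 * u) at_top at_top"
    using f_pos by (intro filterlim_tendsto_pos_mult_at_top[OF tendsto_const] filterlim_ident)
  show "\<forall>\<^sub>F u in at_top. f 0 * u \<le> primitive f u"
    using eventually_ge_at_top[of 0] by eventually_elim (rule primitive_ge)
qed

sublocale F: increasing_profile "primitive f" f
  rewrites "inv_into {0..} (primitive f) = primitive_inv f"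
proof -
  show "increasing_profile (primitive f) f"
  proof
    show "continuous_on {0..b} (primitive f)" for b
      by (rule DERIV_continuous_on[OF primitive_deriv_within])
  qed (auto simp: primitive_def f_pos primitive_at_top intro: primitive_deriv)
qed (simp add: primitive_inv_def)

definition energy :: "real \<Rightarrow> real" where
  "energy v = primitive f (\<gamma> * v) + v\<^sup>2 / 2"

definition energy_slope :: "real \<Rightarrow> real" where
  "energy_slope v = \<gamma> * f (\<gamma> * v) + v"

definition endpoint :: "real \<Rightarrow> real" where
  "endpoint = inv_into {0..} energy"

sublocale E: increasing_profile energy energy_slope
  rewrites "inv_into {0..} energy = endpoint"
proof -
  show "increasing_profile energy energy_slope"
  proof
    show "continuous_on {0..b} energy" for b
      unfolding energy_def[abs_def]
      by (intro continuous_intros continuous_on_compose2[OF F.cont[of "\<gamma> * b"]])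
        (use \<gamma>_pos in auto)
    show "(energy has_real_derivative energy_slope v) (at v)" if "v > 0" for v
      unfolding energy_def[abs_def] energy_slope_def using that \<gamma>_pos
      by (auto intro!: derivative_eq_intros DERIV_chain2[OF primitive_deriv])
    show "filterlim energy at_top at_top"
    proof (rule filterlim_at_top_mono)
      show "filterlim (\<lambda>v. primitive f (\<gamma> * v)) at_top at_top"
        by (intro filterlim_compose[OF primitive_at_top]
            filterlim_tendsto_pos_mult_at_top[OF tendsto_const] \<gamma>_pos filterlim_ident)
    qed (simp add: energy_def)
    show "energy_slope v > 0" if "v > 0" for v
      using that \<gamma>_pos f_pos[of "\<gamma> * v"] by (simp add: energy_slope_def add_pos_pos)
  qed (simp add: energy_def F.at_zero)
qed (simp add: endpoint_def)

text \<open>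
  The endpoint of the orbit lies on the line \<open>u = \<gamma> v\<close>, which replaces \<open>F\<^sup>-\<^sup>1\<close> there by an explicit
  height, and it stays strictly below \<open>sqrt (2 C)\<close>, so the integrand is smooth up to the endpoint.
\<close>

lemma endpoint_energy:
  assumes "C > 0"
  shows endpoint_primitive: "primitive f (\<gamma> * endpoint C) = C - (endpoint C)\<^sup>2 / 2"
    and endpoint_admissible: "(endpoint C)\<^sup>2 / 2 < C"
    and endpoint_height: "primitive_inv f (C - (endpoint C)\<^sup>2 / 2) = \<gamma> * endpoint C"
proof -
  have pos: "0 < \<gamma> * endpoint C"
    using \<gamma>_pos E.inverse_pos[OF assms] by simp
  show eq: "primitive f (\<gamma> * endpoint C) = C - (endpoint C)\<^sup>2 / 2"
    using E.profile_inverse[of C] assms by (simp add: energy_def)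
  show "(endpoint C)\<^sup>2 / 2 < C"
    using F.strictly_increasing[of 0, OF _ pos] F.at_zero eq by simp
  show "primitive_inv f (C - (endpoint C)\<^sup>2 / 2) = \<gamma> * endpoint C"
    using F.inverse_of_profile[of "\<gamma> * endpoint C"] pos by (simp add: eq)
qed

text \<open>The first three derivatives of \<open>F\<^sup>-\<^sup>1\<close>, as functions of the energy.\<close>

definition inv_deriv1 :: "real \<Rightarrow> real" where
  "inv_deriv1 E = 1 / f (primitive_inv f E)"

definition inv_deriv2 :: "real \<Rightarrow> real" where
  "inv_deriv2 E = - f' (primitive_inv f E) / f (primitive_inv f E) ^ 3"

definition inv_deriv3 :: "real \<Rightarrow> real" where
  "inv_deriv3 E = 3 * (f' (primitive_inv f E))\<^sup>2 / f (primitive_inv f E) ^ 5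
     - f'' (primitive_inv f E) / f (primitive_inv f E) ^ 4"

lemma f_inv_deriv:
  "((\<lambda>E. f (primitive_inv f E)) has_real_derivative
     f' (primitive_inv f E) / f (primitive_inv f E)) (at E)" if "E > 0"
  using DERIV_chain2[OF f_deriv F.inverse_deriv[OF that]] by simp

lemma f'_inv_deriv:
  "((\<lambda>E. f' (primitive_inv f E)) has_real_derivative
     f'' (primitive_inv f E) / f (primitive_inv f E)) (at E)" if "E > 0"
  using DERIV_chain2[OF f'_deriv F.inverse_deriv[OF that]] by simp

lemma inv_deriv1_deriv: "(inv_deriv1 has_real_derivative inv_deriv2 E) (at E)" if "E > 0"
  unfolding inv_deriv1_def[abs_def] inv_deriv2_def
  by (rule reciprocal_powers_deriv(1)[OF f_inv_deriv[OF that] f'_inv_deriv[OF that] f_nonzero])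

lemma inv_deriv2_deriv: "(inv_deriv2 has_real_derivative inv_deriv3 E) (at E)" if "E > 0"
  unfolding inv_deriv2_def[abs_def] inv_deriv3_def
  by (rule reciprocal_powers_deriv(2)[OF f_inv_deriv[OF that] f'_inv_deriv[OF that] f_nonzero])

lemma inv_derivs_cont:
  shows inv_deriv1_cont: "continuous_on {0<..} inv_deriv1"
    and inv_deriv2_cont: "continuous_on {0<..} inv_deriv2"
    and inv_deriv3_cont: "continuous_on {0<..} inv_deriv3"
proof -
  show "continuous_on {0<..} inv_deriv1"
    by (rule DERIV_continuous_on[OF has_field_derivative_at_within[OF inv_deriv1_deriv]]) simp
  show "continuous_on {0<..} inv_deriv2"
    by (rule DERIV_continuous_on[OF has_field_derivative_at_within[OF inv_deriv2_deriv]]) simp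
  have "continuous_on {0<..} (primitive_inv f)"
    by (rule DERIV_continuous_on[OF has_field_derivative_at_within[OF F.inverse_deriv]]) simp
  then have comp: "continuous_on {0<..} (\<lambda>E. h (primitive_inv f E))"
    if "continuous_on UNIV h" for h :: "real \<Rightarrow> real"
    by (rule continuous_on_compose2[OF that]) simp
  show "continuous_on {0<..} inv_deriv3"
    unfolding inv_deriv3_def[abs_def]
    by (intro continuous_intros comp[OF f_cont] comp[OF f'_cont] comp[OF f''_cont]) auto
qed

definition half_length :: "real \<Rightarrow> real" where
  "half_length C = integral {0..endpoint C} (\<lambda>v. inv_deriv1 (C - v\<^sup>2 / 2))"

definition half_length' :: "real \<Rightarrow> real" where
  "half_length' C = 1 / (f (\<gamma> * endpoint C) * energy_slope (endpoint C))
     + integral {0..endpoint C} (\<lambda>v. inv_deriv2 (C - v\<^sup>2 / 2))"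

text \<open>
  The last two summands differentiate the integral in \<open>half_length'\<close>, the first one differentiates
  its boundary term; \<open>1 / q\<close> is the speed of the endpoint.
\<close>

definition half_length'' :: "real \<Rightarrow> real" where
  "half_length'' C = (let a = endpoint C; p = f (\<gamma> * a); r = f' (\<gamma> * a); q = energy_slope a in
     - (\<gamma> * r + p * (\<gamma>\<^sup>2 * r + 1) / q) / (p\<^sup>2 * q\<^sup>2) - r / (p ^ 3 * q)
     + integral {0..a} (\<lambda>v. inv_deriv3 (C - v\<^sup>2 / 2)))"

lemma half_length_deriv:
  "(half_length has_real_derivative half_length' C) (at C)" if "C > 0"
proof -
  have "(half_length has_real_derivative
      inv_deriv1 (C - (endpoint C)\<^sup>2 / 2) * (1 / energy_slope (endpoint C))
      + integral {0..endpoint C} (\<lambda>v. inv_deriv2 (C - v\<^sup>2 / 2))) (at C)"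
    unfolding half_length_def[abs_def]
    by (rule moving_endpoint_deriv[OF inv_deriv1_deriv inv_deriv2_cont E.inverse_deriv[OF that]
          E.inverse_pos[OF that] endpoint_admissible[OF that]])
  then show ?thesis
    unfolding half_length'_def inv_deriv1_def endpoint_height[OF that] by simp
qed

lemma half_length'_deriv:
  "(half_length' has_real_derivative half_length'' C) (at C)" if "C > 0"
proof -
  define a where "a = endpoint C"
  define q where "q = energy_slope a"
  have q: "q > 0"
    using E.slope_pos[OF E.inverse_pos[OF that]] by (simp add: q_def a_def)
  have f\<gamma>: "((\<lambda>C. f (\<gamma> * endpoint C)) has_real_derivative f' (\<gamma> * a) * (\<gamma> / q)) (at C)"
    using DERIV_chain2[OF f_deriv DERIV_cmult[OF E.inverse_deriv[OF that]]]
    by (simp add: a_def q_def)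
  have q': "((\<lambda>C. energy_slope (endpoint C)) has_real_derivative
      \<gamma> * (f' (\<gamma> * a) * (\<gamma> / q)) + 1 / q) (at C)"
    unfolding energy_slope_def[abs_def]
    using DERIV_add[OF DERIV_cmult[OF f\<gamma>] E.inverse_deriv[OF that]]
    by (simp add: a_def q_def)
  have nz: "f (\<gamma> * endpoint C) * energy_slope (endpoint C) \<noteq> 0"
    using q by (simp add: a_def q_def)
  have boundary: "((\<lambda>C. 1 / (f (\<gamma> * endpoint C) * energy_slope (endpoint C))) has_real_derivative
      - (f' (\<gamma> * a) * (\<gamma> / q) * q + (\<gamma> * (f' (\<gamma> * a) * (\<gamma> / q)) + 1 / q) * f (\<gamma> * a))
        / (f (\<gamma> * a) * q)\<^sup>2) (at C)"
    by (rule DERIV_cong[OF DERIV_divide[OF DERIV_const DERIV_mult[OF f\<gamma> q'] nz]])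
      (simp add: a_def q_def power2_eq_square)
  have "((\<lambda>C. integral {0..endpoint C} (\<lambda>v. inv_deriv2 (C - v\<^sup>2 / 2))) has_real_derivative
      inv_deriv2 (C - (endpoint C)\<^sup>2 / 2) * (1 / energy_slope (endpoint C))
      + integral {0..endpoint C} (\<lambda>v. inv_deriv3 (C - v\<^sup>2 / 2))) (at C)"
    by (rule moving_endpoint_deriv[OF inv_deriv2_deriv inv_deriv3_cont E.inverse_deriv[OF that]
          E.inverse_pos[OF that] endpoint_admissible[OF that]])
  then have "((\<lambda>C. integral {0..endpoint C} (\<lambda>v. inv_deriv2 (C - v\<^sup>2 / 2))) has_real_derivative
      - f' (\<gamma> * a) / f (\<gamma> * a) ^ 3 * (1 / q) + integral {0..a} (\<lambda>v. inv_deriv3 (C - v\<^sup>2 / 2))) (at C)"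
    by (simp add: inv_deriv2_def endpoint_height[OF that] a_def q_def)
  from DERIV_add[OF boundary this] show ?thesis
    unfolding half_length'_def[abs_def]
    by (rule DERIV_cong)
      (use q in \<open>simp add: half_length''_def Let_def a_def[symmetric] q_def[symmetric]
        field_simps eval_nat_numeral\<close>)
qed

section \<open>Concavity at critical points\<close>

text \<open>
  The Wronskian \<open>D\<close> vanishes at \<open>v = 0\<close> and has derivative \<open>- f''(u) w\<^sup>3 / f(u)\<close>, so it becomes
  negative as long as \<open>w > 0\<close>. Positivity has to be assumed only at the end \<open>b\<close>, since
  \<open>w\<close> has derivative \<open>i\<close>, and \<open>i \<le> 0\<close> because \<open>F\<^sup>-\<^sup>1\<close> is concave.
\<close>

lemma wronskian_negative:
  fixes C b :: real
  defines "I \<equiv> integral {0..b} (\<lambda>v. inv_deriv2 (C - v\<^sup>2 / 2))"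
    and "J \<equiv> integral {0..b} (\<lambda>v. inv_deriv3 (C - v\<^sup>2 / 2))"
    and "u \<equiv> primitive_inv f (C - b\<^sup>2 / 2)"
  assumes b: "0 < b" "b\<^sup>2 / 2 < C"
    and w_pos: "1 / f u + b * I > 0"
  shows "J + 3 * I * f' u / (f u)\<^sup>2 + 3 * b * I\<^sup>2 * f' u / f u
    + b\<^sup>2 * I ^ 3 * f' u + (f u)\<^sup>2 * I ^ 3 < 0"
proof -
  define U where "U = (\<lambda>v. primitive_inv f (C - v\<^sup>2 / 2))"
  define i where "i = (\<lambda>v. integral {0..v} (\<lambda>v. inv_deriv2 (C - v\<^sup>2 / 2)))"
  define j where "j = (\<lambda>v. integral {0..v} (\<lambda>v. inv_deriv3 (C - v\<^sup>2 / 2)))"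
  define w where "w = (\<lambda>v. 1 / f (U v) + v * i v)"
  define D where "D = (\<lambda>v. j v + 3 * i v * f' (U v) / (f (U v))\<^sup>2
    + 3 * v * (i v)\<^sup>2 * f' (U v) / f (U v) + v\<^sup>2 * (i v) ^ 3 * f' (U v) + (f (U v))\<^sup>2 * (i v) ^ 3)"
  define d where "d = (\<lambda>v. - f'' (U v) * (w v) ^ 3 / f (U v))"
  have dom: "0 < C - v\<^sup>2 / 2" if "v \<in> {0..b}" for v
  proof -
    have "v\<^sup>2 \<le> b\<^sup>2" using that by (intro power_mono) auto
    then show ?thesis using b by simp
  qed
  have cont: "continuous_on {0..b} (\<lambda>v. k (C - v\<^sup>2 / 2))" if "continuous_on {0<..} k" for k :: "real \<Rightarrow> real"
    by (intro continuous_on_compose2[OF that] continuous_intros) (auto dest: dom)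
  have di: "(i has_real_derivative inv_deriv2 (C - v\<^sup>2 / 2)) (at v within {0..b})" if "v \<in> {0..b}" for v
    unfolding i_def by (rule integral_has_real_derivative[OF cont[OF inv_deriv2_cont] that])
  have dj: "(j has_real_derivative inv_deriv3 (C - v\<^sup>2 / 2)) (at v within {0..b})" if "v \<in> {0..b}" for v
    unfolding j_def by (rule integral_has_real_derivative[OF cont[OF inv_deriv3_cont] that])
  have dE: "((\<lambda>v. C - v\<^sup>2 / 2) has_real_derivative - v) (at v within {0..b})" for v
    by (auto intro!: derivative_eq_intros)
  have dF: "((\<lambda>v. f (U v)) has_real_derivative - v * f' (U v) / f (U v)) (at v within {0..b})"
    if "v \<in> {0..b}" for v
    using DERIV_chain2[OF f_inv_deriv[OF dom[OF that]] dE[of v]] by (simp add: U_def mult.commute)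
  have dF': "((\<lambda>v. f' (U v)) has_real_derivative - v * f'' (U v) / f (U v)) (at v within {0..b})"
    if "v \<in> {0..b}" for v
    using DERIV_chain2[OF f'_inv_deriv[OF dom[OF that]] dE[of v]] by (simp add: U_def mult.commute)
  have dw: "(w has_real_derivative i v) (at v within {0..b})"
    and dD: "(D has_real_derivative d v) (at v within {0..b})"
    if v: "v \<in> {0..b}" for v
  proof -
    have i': "(i has_real_derivative - f' (U v) / f (U v) ^ 3) (at v within {0..b})"
      using di[OF v] by (simp add: inv_deriv2_def U_def)
    have j': "(j has_real_derivative 3 * (f' (U v))\<^sup>2 / f (U v) ^ 5 - f'' (U v) / f (U v) ^ 4)
        (at v within {0..b})"
      using dj[OF v] by (simp add: inv_deriv3_def U_def)
    show "(w has_real_derivative i v) (at v within {0..b})"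
      unfolding w_def by (rule wronskian_deriv(1)[OF dF[OF v] dF'[OF v] i' j' f_nonzero])
    show "(D has_real_derivative d v) (at v within {0..b})"
      unfolding d_def D_def w_def by (rule wronskian_deriv(2)[OF dF[OF v] dF'[OF v] i' j' f_nonzero])
  qed
  have i_nonpos: "i v \<le> 0" if "v \<in> {0..b}" for v
  proof -
    have "inv_deriv2 E \<le> 0" for E
      unfolding inv_deriv2_def by (rule divide_nonpos_pos) (simp_all add: f'_nonneg f_pos)
    then have "integral {0..v} (\<lambda>v. inv_deriv2 (C - v\<^sup>2 / 2)) \<le> integral {0..v} (\<lambda>v. 0)"
      by (intro integral_le integrable_continuous_real continuous_on_subset[OF cont[OF inv_deriv2_cont]])
        (use that in auto)
    then show ?thesis by (simp add: i_def)
  qed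
  have w: "w v > 0" if v: "v \<in> {0..b}" for v
  proof -
    have "\<exists>x\<in>{v..b}. w b - w v = i x * (b - v)"
      by (rule mvt_very_simple)
        (use v in \<open>auto simp: has_field_derivative_def[symmetric] intro: DERIV_subset[OF dw]\<close>)
    then obtain x where "x \<in> {v..b}" "w b - w v = i x * (b - v)" by blast
    with i_nonpos[of x] v have "w b \<le> w v"
      using mult_nonpos_nonneg[of "i x" "b - v"] by auto
    moreover have "w b > 0"
      using w_pos by (simp add: w_def i_def U_def I_def u_def)
    ultimately show ?thesis by simp
  qed
  have "\<exists>x\<in>{0..b}. D b - D 0 = d x * (b - 0)"
    by (rule mvt_very_simple)
      (use b dD in \<open>auto simp: has_field_derivative_def\<close>)
  then obtain x where x: "x \<in> {0..b}" "D b - D 0 = d x * b"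
    by auto
  have "0 < f'' (U x) * (w x) ^ 3 / f (U x)"
    using w[OF x(1)] f''_pos f_pos by simp
  then have "d x < 0" by (simp add: d_def)
  then have "d x * b < 0" using b by (simp add: mult_neg_pos)
  moreover have "D 0 = 0" by (simp add: D_def i_def j_def)
  ultimately have "D b < 0" using x(2) by simp
  then show ?thesis
    by (simp add: D_def i_def j_def U_def I_def J_def u_def)
qed

text \<open>
  Criticality fixes the integral \<open>I\<close> as \<open>- 1 / (p q)\<close>. This makes \<open>w\<close> positive at the endpoint,
  and it turns \<open>S''\<close> into the Wronskian at the endpoint.
\<close>

lemma half_length''_negative:
  assumes C: "C > 0" and critical: "half_length' C = 0"
  shows "half_length'' C < 0"
proof -
  define a where "a = endpoint C"
  define p where "p = f (\<gamma> * a)"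
  define r where "r = f' (\<gamma> * a)"
  define q where "q = energy_slope a"
  define I where "I = integral {0..a} (\<lambda>v. inv_deriv2 (C - v\<^sup>2 / 2))"
  define J where "J = integral {0..a} (\<lambda>v. inv_deriv3 (C - v\<^sup>2 / 2))"
  have a: "a > 0" and height: "primitive_inv f (C - a\<^sup>2 / 2) = \<gamma> * a"
    using E.inverse_pos[OF C] endpoint_height[OF C] by (auto simp: a_def)
  have p: "p > 0" and q: "q > 0" and q_eq: "q = \<gamma> * p + a"
    using f_pos E.slope_pos[OF a] by (auto simp: p_def q_def energy_slope_def)
  have I: "I = - 1 / (p * q)"
    using critical by (simp add: half_length'_def I_def a_def p_def q_def)
  have "1 / p + a * I = \<gamma> / q"
    using p q by (simp add: I field_simps) (simp add: q_eq algebra_simps)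
  then have "1 / p + a * I > 0"
    using \<gamma>_pos q by simp
  then have "J + 3 * I * r / p\<^sup>2 + 3 * a * I\<^sup>2 * r / p + a\<^sup>2 * I ^ 3 * r + p\<^sup>2 * I ^ 3 < 0"
    using wronskian_negative[OF a endpoint_admissible[OF C, folded a_def]]
    by (simp add: height I_def J_def p_def r_def)
  also have "J + 3 * I * r / p\<^sup>2 + 3 * a * I\<^sup>2 * r / p + a\<^sup>2 * I ^ 3 * r + p\<^sup>2 * I ^ 3
      = - (\<gamma> * r + p * (\<gamma>\<^sup>2 * r + 1) / q) / (p\<^sup>2 * q\<^sup>2) - r / (p ^ 3 * q) + J"
    by (rule boundary_terms_cancel[OF p q _ I]) (simp add: q_eq)
  also have "\<dots> = half_length'' C"
    by (simp add: half_length''_def Let_def a_def p_def q_def r_def J_def)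
  finally show ?thesis .
qed

section \<open>Size of the half-length\<close>

lemma height_bounds:
  assumes C: "C > 0" and v: "v \<in> {0..endpoint C}"
  shows "\<gamma> * endpoint C \<le> primitive_inv f (C - v\<^sup>2 / 2)"
    and "primitive_inv f (C - v\<^sup>2 / 2) \<le> primitive_inv f C"
proof -
  have "v\<^sup>2 \<le> (endpoint C)\<^sup>2" using v by (intro power_mono) auto
  then have E: "C - (endpoint C)\<^sup>2 / 2 \<le> C - v\<^sup>2 / 2" "0 \<le> C - v\<^sup>2 / 2"
    using endpoint_admissible[OF C] by auto
  show "\<gamma> * endpoint C \<le> primitive_inv f (C - v\<^sup>2 / 2)"
    using F.inverse_ge_iff[of "\<gamma> * endpoint C" "C - v\<^sup>2 / 2"] E endpoint_primitive[OF C]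
      \<gamma>_pos E.inverse_pos[OF C] by simp
  show "primitive_inv f (C - v\<^sup>2 / 2) \<le> primitive_inv f C"
    using F.inverse_ge_iff[of "primitive_inv f (C - v\<^sup>2 / 2)" C] E C
    by (simp add: F.profile_inverse F.inverse_nonneg)
qed

lemma half_length_bounds:
  assumes C: "C > 0"
  shows half_length_pos: "half_length C > 0"
    and half_length_le: "half_length C \<le> endpoint C / f (\<gamma> * endpoint C)"
proof -
  let ?a = "endpoint C"
  have a: "?a > 0" using C by (rule E.inverse_pos)
  have "0 < C - v\<^sup>2 / 2" if "v \<in> {0..?a}" for v
  proof -
    have "v\<^sup>2 \<le> ?a\<^sup>2" using that by (intro power_mono) auto
    then show ?thesis using endpoint_admissible[OF C] by simp
  qed
  then have "continuous_on {0..?a} (\<lambda>v. inv_deriv1 (C - v\<^sup>2 / 2))"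
    by (intro continuous_on_compose2[OF inv_deriv1_cont] continuous_intros) auto
  then have int: "(\<lambda>v. inv_deriv1 (C - v\<^sup>2 / 2)) integrable_on {0..?a}"
    by (rule integrable_continuous_real)
  have "integral {0..?a} (\<lambda>_. 1 / f (primitive_inv f C)) \<le> half_length C"
    unfolding half_length_def
    by (intro integral_le int integrable_const_ivl)
      (auto simp: inv_deriv1_def intro!: divide_left_mono f_mono height_bounds(2) C f_pos mult_pos_pos)
  moreover have "integral {0..?a} (\<lambda>_. 1 / f (primitive_inv f C)) > 0"
    using a f_pos by simp
  ultimately show "half_length C > 0" by linarith
  have "half_length C \<le> integral {0..?a} (\<lambda>_. 1 / f (\<gamma> * ?a))"
    unfolding half_length_def
    by (intro integral_le int integrable_const_ivl)
      (auto simp: inv_deriv1_def intro!: divide_left_mono f_mono height_bounds(1) C f_pos mult_pos_pos)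
  then show "half_length C \<le> ?a / f (\<gamma> * ?a)" using a by simp
qed

lemma half_length_at_right_0: "(half_length \<longlongrightarrow> 0) (at_right 0)"
proof (rule tendsto_sandwich)
  show "\<forall>\<^sub>F C in at_right 0. 0 \<le> half_length C"
    using eventually_at_right_less by eventually_elim (rule less_imp_le[OF half_length_pos])
  show "\<forall>\<^sub>F C in at_right 0. half_length C \<le> endpoint C / f 0"
    using eventually_at_right_less
  proof eventually_elim
    case (elim C)
    have "endpoint C / f (\<gamma> * endpoint C) \<le> endpoint C / f 0"
      using E.inverse_pos[OF elim] \<gamma>_pos f_pos by (intro divide_left_mono f_mono mult_pos_pos) auto
    with half_length_le[OF elim] show ?case by linarith
  qed
  show "((\<lambda>C. endpoint C / f 0) \<longlongrightarrow> 0) (at_right 0)"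
    using tendsto_divide[OF E.inverse_tendsto_0 tendsto_const[of "f 0"]] by simp
qed simp

lemma half_length_at_top: "(half_length \<longlongrightarrow> 0) at_top"
proof (rule tendsto_sandwich)
  show "\<forall>\<^sub>F C in at_top. 0 \<le> half_length C"
    using eventually_gt_at_top[of 0] by eventually_elim (rule less_imp_le[OF half_length_pos])
  show "\<forall>\<^sub>F C in at_top. half_length C \<le> endpoint C / f (\<gamma> * endpoint C)"
    using eventually_gt_at_top[of 0] by eventually_elim (rule half_length_le)
  have "((\<lambda>u. inverse (f u / u)) \<longlongrightarrow> 0) at_top"
    using superlinear by (rule tendsto_inverse_0_at_top)
  moreover have "filterlim (\<lambda>C. \<gamma> * endpoint C) at_top at_top"
    by (intro filterlim_tendsto_pos_mult_at_top[OF tendsto_const] \<gamma>_pos E.inverse_at_top)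
  ultimately have "((\<lambda>C. inverse (f (\<gamma> * endpoint C) / (\<gamma> * endpoint C))) \<longlongrightarrow> 0) at_top"
    by (rule filterlim_compose)
  from tendsto_mult_right_zero[OF this, of "1 / \<gamma>"]
  show "((\<lambda>C. endpoint C / f (\<gamma> * endpoint C)) \<longlongrightarrow> 0) at_top"
    using \<gamma>_pos by (simp add: field_simps)
qed simp

section \<open>The length function of the Robin problem\<close>

lemma robin_length_eq_half_length:
  assumes "\<gamma> = gamma_star \<alpha> lam" and C: "C > 0"
  shows "robin_length f \<alpha> lam C = 2 / sqrt lam * half_length C"
proof -
  have v1: "v1 f \<alpha> lam C = endpoint C"
    unfolding v1_def
  proof (rule the_equality)
    show "endpoint C > 0 \<and> primitive f (gamma_star \<alpha> lam * endpoint C) + (endpoint C)\<^sup>2 / 2 = C"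
      using endpoint_primitive[OF C] E.inverse_pos[OF C] assms(1) by simp
    show "v = endpoint C"
      if v: "v > 0 \<and> primitive f (gamma_star \<alpha> lam * v) + v\<^sup>2 / 2 = C" for v
    proof -
      have "energy v = C" using v by (simp add: energy_def assms(1)[symmetric])
      then show ?thesis using E.inverse_of_profile[of v] v by simp
    qed
  qed
  have "(\<lambda>v. 1 / (sqrt lam * f (primitive_inv f (C - v\<^sup>2 / 2))))
      = (\<lambda>v. 1 / sqrt lam * inv_deriv1 (C - v\<^sup>2 / 2))"
    by (simp add: inv_deriv1_def)
  then show ?thesis
    by (simp add: robin_length_def v1 half_length_def del: times_divide_eq_left)
qed

end

theorem theorem3p5:
  fixes f f' f'' :: "real \<Rightarrow> real" and \<alpha> lam :: real
  assumes "\<And>u. (f has_real_derivative f' u) (at u)"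
    and "\<And>u. (f' has_real_derivative f'' u) (at u)"
    and "continuous_on UNIV f''"
    and "\<And>u. f u > 0"
    and "\<And>u. f' u \<ge> 0"
    and "\<And>u. f'' u > 0"
    and "filterlim (\<lambda>u. f u / u) at_top at_top"
    and "\<alpha> > 0"
    and "lam > 0"
  shows "bounded (robin_length f \<alpha> lam ` {0<..})
    \<and> (robin_length f \<alpha> lam \<longlongrightarrow> 0) (at_right 0)
    \<and> (robin_length f \<alpha> lam \<longlongrightarrow> 0) at_top
    \<and> (\<forall>C>0. robin_length f \<alpha> lam differentiable (at C))
    \<and> (\<exists>!C. C > 0 \<and> (robin_length f \<alpha> lam has_real_derivative 0) (at C))"
proof -
  interpret robin_problem f f' f'' "gamma_star \<alpha> lam"
    using assms by unfold_locales (auto simp: gamma_star_def)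
  define L where "L = robin_length f \<alpha> lam"
  define c where "c = 2 / sqrt lam"
  have c: "c > 0" using assms(9) by (simp add: c_def)
  have L_eq: "L C = c * half_length C" if "C > 0" for C
    unfolding L_def c_def using robin_length_eq_half_length[OF refl that] .
  have L_pos: "L C > 0" if "C > 0" for C
    using L_eq[OF that] half_length_pos[OF that] c by simp
  have L_deriv: "(L has_real_derivative c * half_length' C) (at C)" if "C > 0" for C
    by (rule has_field_derivative_transform_within_open[OF DERIV_cmult[OF half_length_deriv[OF that]],
          of "{0<..}"])
      (use that in \<open>auto simp: L_eq\<close>)
  have L_0: "(L \<longlongrightarrow> 0) (at_right 0)"
  proof (rule Lim_transform_eventually[OF tendsto_mult_right_zero[OF half_length_at_right_0, of c]])
    show "\<forall>\<^sub>F C in at_right 0. c * half_length C = L C"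
      using eventually_at_right_less by eventually_elim (simp add: L_eq)
  qed
  have L_top: "(L \<longlongrightarrow> 0) at_top"
  proof (rule Lim_transform_eventually[OF tendsto_mult_right_zero[OF half_length_at_top, of c]])
    show "\<forall>\<^sub>F C in at_top. c * half_length C = L C"
      using eventually_gt_at_top[of 0] by eventually_elim (simp add: L_eq)
  qed
  obtain M where M: "M > 0" "c * half_length' M = 0" "\<And>C. C > 0 \<Longrightarrow> L C \<le> L M"
    using interior_maximum_critical[OF L_deriv L_pos L_0 L_top] by blast
  have "norm (L C) \<le> L M" if "C \<in> {0<..}" for C
    using L_pos[of C] M(3)[of C] that by simp
  then have bdd: "bounded (L ` {0<..})"
    by (auto intro!: boundedI)
  have "\<exists>!C. C > 0 \<and> (L has_real_derivative 0) (at C)"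
  proof (intro ex1I conjI)
    show "M > 0" "(L has_real_derivative 0) (at M)"
      using M(1) L_deriv[OF M(1)] unfolding M(2) by simp_all
    fix C assume C: "C > 0 \<and> (L has_real_derivative 0) (at C)"
    have "c * half_length' C = 0"
      by (rule DERIV_unique[OF L_deriv]) (use C in auto)
    then have zeros: "half_length' C = 0" "half_length' M = 0"
      using M(2) c by auto
    show "C = M"
      by (rule unique_zero_of_downcrossings[OF half_length'_deriv half_length''_negative])
        (use C M(1) zeros in auto)
  qed
  moreover have "\<forall>C>0. L differentiable (at C)"
    using L_deriv real_differentiable_def by blast
  ultimately show ?thesis
    using bdd L_0 L_top unfolding L_def by blast
qed

end
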